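(* Let $\lambda,\mu\in\mathbb{R}$. The double inequality $$\lambda\left[\tfrac16 C(a,b)+\tfrac56 A(a,b)\right]+(1-\lambda)C^{1/6}(a,b)A^{5/6}(a,b)<M(a,b)<\mu\left[\tfrac16 C(a,b)+\tfrac56 A(a,b)\right]+(1-\mu)C^{1/6}(a,b)A^{5/6}(a,b)$$ holds for all $a,b>0$ with $a\neq b$ if and only if $$\lambda\leq \frac{6-6\sqrt[6]{2}\,\log(1+\sqrt{2})}{(7-6\sqrt[6]{2})\log(1+\sqrt{2})}=0.274\cdots\quad\text{and}\quad \mu\geq \frac{8}{25}.$$
   Context: For $a,b>0$ with $a\neq b$: the Neuman-Sándor mean is $M(a,b)=\dfrac{a-b}{2\,\mathrm{arcsinh}\left(\frac{a-b}{a+b}\right)}$, where $\mathrm{arcsinh}$ is the inverse hyperbolic sine; the arithmetic mean is $A(a,b)=\frac{a+b}{2}$; the contra-harmonic mean is $C(a,b)=\frac{a^2+b^2}{a+b}$. The notation $C^{1/6}(a,b)$ means $(C(a,b))^{1/6}$, and similarly for other powers. $\log$ is the natural logarithm. *)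

theory Defs
  imports Complex_Main
begin

text \<open>
  The means are taken of positive reals \<^term>\<open>a\<close> and \<^term>\<open>b\<close>. The Neuman--Sandor mean is given for
  \<^term>\<open>a \<noteq> b\<close> only; on the diagonal the value below is the meaningless \<open>0 / 0 = 0\<close>.
\<close>

definition neuman_sandor_mean :: "real \<Rightarrow> real \<Rightarrow> real" where
  "neuman_sandor_mean a b = (a - b) / (2 * arsinh ((a - b) / (a + b)))"

definition arithmetic_mean :: "real \<Rightarrow> real \<Rightarrow> real" where
  "arithmetic_mean a b = (a + b) / 2"

definition contraharmonic_mean :: "real \<Rightarrow> real \<Rightarrow> real" where
  "contraharmonic_mean a b = (a\<^sup>2 + b\<^sup>2) / (a + b)"

end

(* Put v = (a - b) / (a + b) and t = (1 + v^2)^(1/6), so that 1 < t < 2^(1/6). Dividing the three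
   means by A turns C into t^6, C^(1/6) A^(5/6) into t and M into v / arsinh v, and the claim compares
   v / arsinh v with U_l(t) = t + l ((t^6 + 5) / 6 - t), i.e. it asks for the sign of the gap
   arsinh v - v / U_l(t) as a function of t. The gap vanishes at t = 1 and its derivative is a positive
   multiple of a polynomial Q_l(t - 1) whose coefficients, except the constant one 75/2 (l - 8/25),
   are positive for l >= 1/5, so Q_l is increasing. If l >= 8/25 the gap is therefore positive; if
   l < 8/25 it is negative near 1. For the optimal lambda it also vanishes at t = 2^(1/6), hence it
   first decreases, then increases, and is negative in between. *)

theory Submission
  imports Defs "HOL-Analysis.Harmonic_Numbers"
begin

section \<open>The gap function and its derivative\<close>

definition mean_comb :: "real \<Rightarrow> real \<Rightarrow> real" where
  "mean_comb l t = t + l * ((t^6 + 5) / 6 - t)"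

text \<open>Comparing \<open>arsinh v\<close> with \<open>v / U\<close> rather than
  \<open>v / arsinh v\<close> with \<open>U\<close> leaves no \<open>arsinh\<close> in the
  derivative, which becomes algebraic in \<open>t\<close>.\<close>

definition arsinh_gap :: "real \<Rightarrow> real \<Rightarrow> real" where
  "arsinh_gap l t = arsinh (sqrt (t^6 - 1)) - sqrt (t^6 - 1) / mean_comb l t"

definition gap_poly :: "real \<Rightarrow> real \<Rightarrow> real" where
  "gap_poly l s =
     (75/2 * l - 12) + (305/2 * l - 28) * s + (75/4 * l^2 + 595/2 * l - 27) * s^2
     + (175/2 * l^2 + 731/2 * l - 12) * s^3 + (2275/12 * l^2 + 317 * l - 2) * s^4
     + (770/3 * l^2 + 201 * l) * s^5 + (2905/12 * l^2 + 183/2 * l) * s^6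
     + (995/6 * l^2 + 57/2 * l) * s^7 + (1001/12 * l^2 + 11/2 * l) * s^8
     + (91/3 * l^2 + 1/2 * l) * s^9 + (91/12 * l^2) * s^10 + (7/6 * l^2) * s^11
     + (1/12 * l^2) * s^12"

text \<open>The right-hand side is the numerator of the derivative of the gap. It is quadratic in
  \<open>l\<close>, and each of its three coefficients has a double zero at \<open>t = 1\<close>,
  which is split off here.\<close>

lemma gap_poly_eq:
  "(t - 1)^2 * gap_poly l (t - 1) =
     3 * t^2 * (mean_comb l t)^2 - 3 * t^5 * mean_comb l t + (1 + l * (t^5 - 1)) * (t^6 - 1)"
proof -
  define s D where "s = t - 1" and "D = (t^6 + 5) / 6 - t"
  have t: "t = 1 + s" by (simp add: s_def)
  have D: "D = s^6 / 6 + s^5 + 5/2 * s^4 + 10/3 * s^3 + 5/2 * s^2"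
    unfolding D_def t by (simp add: field_simps eval_nat_numeral)
  \<comment> \<open>\<open>c0\<close>, \<open>c1\<close> and \<open>c2\<close> expand the
    coefficients of \<open>l^0\<close>, \<open>l^1\<close> and \<open>l^2\<close> in powers of
    \<open>s\<close>.\<close>
  have c0: "3 * t^4 - 2 * t^6 - 1 = s^2 * (- 12 - 28 * s - 27 * s^2 - 12 * s^3 - 2 * s^4)"
    unfolding t by (simp add: algebra_simps eval_nat_numeral)
  have c1: "(6 * t^3 - 3 * t^5) * D + (t^5 - 1) * (t^6 - 1)
      = s^2 * (75/2 + 305/2 * s + 595/2 * s^2 + 731/2 * s^3 + 317 * s^4 + 201 * s^5
          + 183/2 * s^6 + 57/2 * s^7 + 11/2 * s^8 + 1/2 * s^9)"
    unfolding D t by (simp add: field_simps eval_nat_numeral)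
  have c2: "3 * (t * D)^2
      = s^2 * (75/4 * s^2 + 175/2 * s^3 + 2275/12 * s^4 + 770/3 * s^5 + 2905/12 * s^6
          + 995/6 * s^7 + 1001/12 * s^8 + 91/3 * s^9 + 91/12 * s^10 + 7/6 * s^11 + 1/12 * s^12)"
    unfolding D t by (simp add: field_simps eval_nat_numeral)
  have "3 * t^2 * (mean_comb l t)^2 - 3 * t^5 * mean_comb l t + (1 + l * (t^5 - 1)) * (t^6 - 1)
      = (3 * t^4 - 2 * t^6 - 1) + l * ((6 * t^3 - 3 * t^5) * D + (t^5 - 1) * (t^6 - 1))
          + l^2 * (3 * (t * D)^2)"
    unfolding mean_comb_def D_def[symmetric] by algebra
  also have "\<dots> = s^2 * gap_poly l s"
    unfolding c0 c1 c2 gap_poly_def by algebra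
  finally show ?thesis by (simp add: s_def)
qed

text \<open>The linear coefficient is positive only for \<open>l > 56/305\<close>. The bound 1/5 is
  a convenient value above this and below both critical constants, 8/25 and
  \<open>lambda_opt\<close>.\<close>

lemma gap_poly_strict_mono:
  assumes l: "l \<ge> 1/5" and s: "0 \<le> s" "s < s'"
  shows "gap_poly l s < gap_poly l s'"
proof -
  have m: "c * s^n \<le> c * s'^n" if "c \<ge> 0" for c n
    using that s by (intro mult_left_mono power_mono) auto
  have "(305/2 * l - 28) * s < (305/2 * l - 28) * s'"
    using l s by (intro mult_strict_left_mono) auto
  moreover have "l^2 \<ge> 0" by simp
  ultimately show ?thesis
    unfolding gap_poly_def using l
    by (intro add_less_le_mono add_le_less_mono m order_refl) linarith+
qed

text \<open>This is weighted AM-GM for \<open>t^6\<close> and 1 with weights 1/6 and 5/6; all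
  coefficients of the expansion at \<open>t = 1\<close> are nonnegative. It makes
  \<open>mean_comb\<close> increasing in \<open>l\<close>.\<close>

lemma mean_comb_slope_pos:
  assumes "t > (1::real)"
  shows "(t^6 + 5) / 6 - t > 0"
proof -
  define s where "s = t - 1"
  have t: "t = 1 + s" and s: "s > 0" using assms by (auto simp: s_def)
  have "(t^6 + 5) / 6 - t = s^6 / 6 + s^5 + 5/2 * s^4 + 10/3 * s^3 + 5/2 * s^2"
    unfolding t by (simp add: field_simps eval_nat_numeral)
  also have "\<dots> > 0" using s by (intro add_pos_pos) auto
  finally show ?thesis .
qed

lemma mean_comb_mono:
  assumes "t > 1" "l \<le> l'"
  shows "mean_comb l t \<le> mean_comb l' t"
  using mult_right_mono[OF assms(2) less_imp_le[OF mean_comb_slope_pos[OF assms(1)]]]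
  by (simp add: mean_comb_def)

lemma mean_comb_pos:
  assumes "t \<ge> 1" "l \<ge> 0"
  shows "mean_comb l t > 0"
proof (cases "t = 1")
  case True
  then show ?thesis by (simp add: mean_comb_def)
next
  case False
  then have "t > 1" using assms by simp
  from mean_comb_mono[OF this assms(2)] this show ?thesis by (simp add: mean_comb_def)
qed

text \<open>With \<open>w = sqrt (t^6 - 1)\<close> one has \<open>sqrt (w^2 + 1) = t^3\<close>, so
  the chain rule for \<open>arsinh\<close> yields only powers of \<open>t\<close> and
  \<open>w\<close>.\<close>

lemma arsinh_gap_has_derivative:
  assumes t: "t > 1" and l: "l \<ge> 0"
  shows "(arsinh_gap l has_real_derivative
           (t - 1)^2 * gap_poly l (t - 1) / (sqrt (t^6 - 1) * (mean_comb l t)^2)) (at t)"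
proof -
  have t6: "t^6 > 1" using t by simp
  define w where "w = sqrt (t^6 - 1)"
  have w: "w > 0" "w^2 = t^6 - 1" using t6 by (auto simp: w_def)
  have "w^2 + 1 = (t^3)^2" using w by simp
  then have w1: "sqrt (w^2 + 1) = t^3" using t by (simp add: real_sqrt_unique)
  have U: "mean_comb l t > 0" using mean_comb_pos t l by simp
  have dw: "((\<lambda>t. sqrt (t^6 - 1)) has_real_derivative 3 * t^5 / w) (at t)"
    using t6 by (auto intro!: derivative_eq_intros simp: w_def field_simps)
  have dU: "(mean_comb l has_real_derivative 1 + l * (t^5 - 1)) (at t)"
    unfolding mean_comb_def by (auto intro!: derivative_eq_intros)
  have da: "((\<lambda>t. arsinh (sqrt (t^6 - 1))) has_real_derivative 1 / t^3 * (3 * t^5 / w)) (at t)"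
    using DERIV_chain2[OF arsinh_real_has_field_derivative dw] by (simp add: w_def[symmetric] w1)
  have "(arsinh_gap l has_real_derivative
      1 / t^3 * (3 * t^5 / w) - (3 * t^5 / w * mean_comb l t - w * (1 + l * (t^5 - 1)))
        / (mean_comb l t * mean_comb l t)) (at t)"
    unfolding arsinh_gap_def [abs_def]
    using DERIV_diff[OF da DERIV_divide[OF dw dU]] U by (simp add: w_def)
  moreover have "1 / t^3 * (3 * t^5 / w)
        - (3 * t^5 / w * u - w * d) / (u * u)
      = (3 * t^2 * u^2 - 3 * t^5 * u + d * w^2) / (w * u^2)" if "u > 0" for u d
  proof -
    have "1 / t^3 * (3 * t^5 / w) = 3 * t^2 / w"
      using t by (simp add: field_simps eval_nat_numeral)
    then show ?thesis
      using that w(1) by (simp add: field_simps power2_eq_square)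
  qed
  ultimately show ?thesis
    using U w(2) unfolding gap_poly_eq w_def[symmetric] by simp
qed

text \<open>Continuity includes \<open>t = 1\<close>, where the derivative formula divides by zero,
  so the mean value theorem can start there.\<close>

lemma arsinh_gap_isCont:
  assumes "t \<ge> 1" "l \<ge> 0"
  shows "isCont (arsinh_gap l) t"
proof -
  have "isCont (mean_comb l) t" unfolding mean_comb_def by (intro continuous_intros) auto
  then show ?thesis
    unfolding arsinh_gap_def [abs_def] using mean_comb_pos[OF assms]
    by (intro continuous_intros isCont_o2[where g = arsinh]) auto
qed

text \<open>All positive factors of the derivative and the interval length are absorbed into
  \<open>k\<close>; only the sign of \<open>gap_poly\<close> matters later.\<close>

lemma arsinh_gap_MVT:
  assumes "1 \<le> x" "x < y" "l \<ge> 0"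
  obtains z k where "x < z" "z < y" "k > 0"
    "arsinh_gap l y - arsinh_gap l x = k * gap_poly l (z - 1)"
proof -
  let ?D = "\<lambda>z. (z - 1)^2 * gap_poly l (z - 1) / (sqrt (z^6 - 1) * (mean_comb l z)^2)"
  have "continuous_on {x..y} (arsinh_gap l)"
    using assms by (auto intro!: continuous_at_imp_continuous_on arsinh_gap_isCont)
  moreover have "(arsinh_gap l has_derivative (*) (?D z)) (at z)" if "x < z" "z < y" for z
    using arsinh_gap_has_derivative[of z l] that assms by (simp add: has_field_derivative_def)
  ultimately obtain z where z: "x < z" "z < y"
      and eq: "arsinh_gap l y - arsinh_gap l x = ?D z * (y - x)"
    using mvt[OF assms(2), of "arsinh_gap l" "\<lambda>z. (*) (?D z)"] by blast
  define k where "k = (z - 1)^2 * (y - x) / (sqrt (z^6 - 1) * (mean_comb l z)^2)"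
  have "z > 1" using z assms by simp
  moreover have "mean_comb l z > 0" using \<open>z > 1\<close> assms(3) by (simp add: mean_comb_pos)
  ultimately have "k > 0" using z by (simp add: k_def)
  moreover have "arsinh_gap l y - arsinh_gap l x = k * gap_poly l (z - 1)"
    unfolding eq k_def by simp
  ultimately show thesis using that z by blast
qed

section \<open>Sign of the gap\<close>

lemma arsinh_gap_1 [simp]: "arsinh_gap l 1 = 0"
  by (simp add: arsinh_gap_def)

lemma arsinh_gap_pos:
  assumes "l \<ge> 8/25" "t > 1"
  shows "arsinh_gap l t > 0"
proof -
  obtain z k where z: "1 < z" "z < t" "k > 0"
      "arsinh_gap l t - arsinh_gap l 1 = k * gap_poly l (z - 1)"
    by (rule arsinh_gap_MVT[of 1 t l]) (use assms in auto)
  have "0 \<le> gap_poly l 0" using assms by (simp add: gap_poly_def)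
  also have "\<dots> < gap_poly l (z - 1)"
    using assms z by (intro gap_poly_strict_mono) auto
  finally show ?thesis using z by simp
qed

lemma arsinh_gap_neg_near_1:
  assumes "1/5 \<le> l" "l < 8/25" "c > 1"
  obtains t where "1 < t" "t < c" "arsinh_gap l t < 0"
proof -
  have "isCont (gap_poly l) 0"
    unfolding gap_poly_def [abs_def] by (intro continuous_intros)
  then have "(gap_poly l \<longlongrightarrow> gap_poly l 0) (at_right 0)"
    by (auto simp: isCont_def intro: tendsto_within_subset)
  moreover have "gap_poly l 0 < 0" using assms by (simp add: gap_poly_def)
  ultimately have "eventually (\<lambda>s. gap_poly l s < 0) (at_right 0)"
    by (rule order_tendstoD)
  then obtain d where d: "d > 0" "\<And>s. 0 < s \<Longrightarrow> s < d \<Longrightarrow> gap_poly l s < 0"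
    by (auto simp: eventually_at_right_field)
  define t where "t = 1 + min d (c - 1) / 2"
  have t: "1 < t" "t < c" "t < 1 + d" using d assms by (auto simp: t_def min_def field_simps)
  obtain z k where z: "1 < z" "z < t" "k > 0"
      "arsinh_gap l t - arsinh_gap l 1 = k * gap_poly l (z - 1)"
    by (rule arsinh_gap_MVT[of 1 t l]) (use assms t in auto)
  have "gap_poly l (z - 1) < 0" using d z t by simp
  then have "arsinh_gap l t < 0" using z by (simp add: mult_pos_neg)
  with t that show thesis by blast
qed

text \<open>A nonnegative gap at \<open>t\<close> would force \<open>gap_poly\<close> to be
  nonnegative somewhere before \<open>t\<close> and nonpositive somewhere after it, against strict
  monotonicity.\<close>

lemma arsinh_gap_neg_before_zero:
  assumes l: "1/5 \<le> l" and zero: "arsinh_gap l c = 0" and t: "1 < t" "t < c"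
  shows "arsinh_gap l t < 0"
proof (rule ccontr)
  assume nonneg: "\<not> arsinh_gap l t < 0"
  obtain z k where z: "1 < z" "z < t" "k > 0"
      "arsinh_gap l t - arsinh_gap l 1 = k * gap_poly l (z - 1)"
    by (rule arsinh_gap_MVT[of 1 t l]) (use l t in auto)
  obtain z' k' where z': "t < z'" "z' < c" "k' > 0"
      "arsinh_gap l c - arsinh_gap l t = k' * gap_poly l (z' - 1)"
    by (rule arsinh_gap_MVT[of t c l]) (use l t in auto)
  have "0 \<le> gap_poly l (z - 1)"
    using nonneg z by (simp add: not_less zero_le_mult_iff)
  also have "\<dots> < gap_poly l (z' - 1)"
    using l z z' by (intro gap_poly_strict_mono) auto
  finally have "k' * gap_poly l (z' - 1) > 0" using z' by simp
  then show False using z' zero nonneg by simp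
qed

lemma mean_comb_compare_iff:
  assumes "t > 1" "l \<ge> 0"
  shows "sqrt (t^6 - 1) / arsinh (sqrt (t^6 - 1)) < mean_comb l t \<longleftrightarrow> arsinh_gap l t > 0"
    and "mean_comb l t < sqrt (t^6 - 1) / arsinh (sqrt (t^6 - 1)) \<longleftrightarrow> arsinh_gap l t < 0"
proof -
  have "arsinh (sqrt (t^6 - 1)) > 0" "mean_comb l t > 0"
    using assms by (auto intro: mean_comb_pos)
  then show "sqrt (t^6 - 1) / arsinh (sqrt (t^6 - 1)) < mean_comb l t \<longleftrightarrow> arsinh_gap l t > 0"
    and "mean_comb l t < sqrt (t^6 - 1) / arsinh (sqrt (t^6 - 1)) \<longleftrightarrow> arsinh_gap l t < 0"
    by (auto simp: arsinh_gap_def field_simps)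
qed

section \<open>The optimal constant for the lower bound\<close>

definition lambda_opt :: real where
  "lambda_opt = (6 - 6 * root 6 2 * ln (1 + sqrt 2)) / ((7 - 6 * root 6 2) * ln (1 + sqrt 2))"

text \<open>Numerator and denominator of \<open>lambda_opt\<close> are small differences of larger
  numbers, so three decimals of it require tight bounds on its ingredients.\<close>

lemma root_6_2_bounds: "root 6 2 > (1.122462 :: real)" "root 6 2 < (1.122463 :: real)"
proof -
  have "root 6 (1.122462^6) < root 6 (2::real)"
    by (intro real_root_less_mono) (auto simp: eval_nat_numeral)
  then show "root 6 2 > (1.122462 :: real)" by (simp add: real_root_power_cancel)
  have "root 6 2 < root 6 (1.122463^6 :: real)"
    by (intro real_root_less_mono) (auto simp: eval_nat_numeral)
  then show "root 6 2 < (1.122463 :: real)" by (simp add: real_root_power_cancel)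
qed

lemma ln_1_plus_sqrt_2_bounds:
  "ln (1 + sqrt 2) > (0.88136 :: real)" "ln (1 + sqrt 2) < (0.88138 :: real)"
proof -
  have s: "sqrt 2 > (1.4142 :: real)" "sqrt 2 < (1.41422 :: real)"
    by (rule real_less_rsqrt, simp add: power2_eq_square)
      (rule real_less_lsqrt, simp_all add: power2_eq_square)
  have "(0.88136 :: real) < ln 2.4142"
    \<comment> \<open>The 6 counts the terms kept of the series of
      \<open>2 * artanh ((x - 1) / (x + 1))\<close>, which equals \<open>ln x\<close>.\<close>
    using ln_approx_bounds[of "2.4142" 6] by (simp add: lessThan_nat_numeral lessThan_Suc power_divide)
  also have "\<dots> < ln (1 + sqrt 2)" using s by simp
  finally show "ln (1 + sqrt 2) > (0.88136 :: real)" .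
  have "ln (1 + sqrt 2) < ln (2.41422 :: real)" using s by (subst ln_less_cancel_iff) auto
  also have "\<dots> < 0.88138"
    using ln_approx_bounds[of "2.41422" 6] by (simp add: lessThan_nat_numeral lessThan_Suc power_divide)
  finally show "ln (1 + sqrt 2) < (0.88138 :: real)" .
qed

lemma lambda_opt_bounds: "0.274 \<le> lambda_opt" "lambda_opt < 0.275"
proof -
  define c L where "c = root 6 (2::real)" and "L = ln (1 + sqrt 2 :: real)"
  have c: "c > 1.122462" "c < 1.122463" and L: "L > 0.88136" "L < 0.88138"
    using root_6_2_bounds ln_1_plus_sqrt_2_bounds by (auto simp: c_def L_def)
  have pos: "(7 - 6 * c) * L > 0" using c L by simp
  \<comment> \<open>Naming the product makes both inequalities linear in \<open>L\<close> and
    \<open>p\<close>.\<close>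
  define p where "p = c * L"
  have expand: "(7 - 6 * c) * L = 7 * L - 6 * p" "6 * c * L = 6 * p"
    by (simp_all add: p_def left_diff_distrib)
  have "p \<le> 1.122463 * 0.88138" unfolding p_def using c L by (intro mult_mono) auto
  then have "0.274 * ((7 - 6 * c) * L) \<le> 6 - 6 * c * L"
    using L unfolding expand by simp
  then show "0.274 \<le> lambda_opt"
    using pos unfolding lambda_opt_def c_def[symmetric] L_def[symmetric]
    by (subst pos_le_divide_eq) auto
  have "p \<ge> 1.122462 * 0.88136" unfolding p_def using c L by (intro mult_mono) auto
  then have "6 - 6 * c * L < 0.275 * ((7 - 6 * c) * L)"
    using L unfolding expand by simp
  then show "lambda_opt < 0.275"
    using pos unfolding lambda_opt_def c_def[symmetric] L_def[symmetric]
    by (subst pos_divide_less_eq) auto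
qed

text \<open>The endpoint \<open>root 6 2\<close> corresponds to \<open>v = 1\<close>, where
  \<open>v / arsinh v\<close> is \<open>1 / arsinh 1\<close>. There \<open>mean_comb\<close> is
  affine in \<open>l\<close>, and \<open>lambda_opt\<close> is the parameter giving
  equality.\<close>

lemma mean_comb_root_6_2:
  "mean_comb l (root 6 2) = 1 / arsinh 1 + (l - lambda_opt) * (7/6 - root 6 2)"
proof -
  define c L where "c = root 6 (2::real)" and "L = ln (1 + sqrt 2 :: real)"
  have cL: "7 - 6 * c \<noteq> 0" "L \<noteq> 0"
    using root_6_2_bounds ln_1_plus_sqrt_2_bounds by (auto simp: c_def L_def)
  have "mean_comb l c = c + l * (7/6 - c)"
    by (simp add: mean_comb_def c_def)
  moreover have "lambda_opt * (7/6 - c) = 1 / L - c"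
  proof -
    have "lambda_opt * (7 - 6 * c) = (6 - 6 * c * L) / L"
      unfolding lambda_opt_def c_def[symmetric] L_def[symmetric] using cL by simp
    also have "\<dots> = 6 / L - 6 * c" using cL by (simp add: field_simps)
    finally show ?thesis by (simp add: algebra_simps)
  qed
  moreover have "arsinh 1 = L" by (simp add: arsinh_real_def L_def)
  ultimately show ?thesis
    unfolding c_def[symmetric] by (simp add: left_diff_distrib)
qed

section \<open>The double inequality in the variable \<open>t\<close>\<close>

lemma mean_comb_bounds_iff:
  "(\<forall>t. 1 < t \<and> t < root 6 2 \<longrightarrow>
      mean_comb lam t < sqrt (t^6 - 1) / arsinh (sqrt (t^6 - 1))
      \<and> sqrt (t^6 - 1) / arsinh (sqrt (t^6 - 1)) < mean_comb mu t)
    \<longleftrightarrow> lam \<le> lambda_opt \<and> mu \<ge> 8/25" (is "?L \<longleftrightarrow> _")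
proof safe
  assume L: ?L
  let ?m = "\<lambda>t. sqrt (t^6 - 1) / arsinh (sqrt (t^6 - 1))"
  have c: "root 6 2 > (1::real)" "root 6 2 < (7/6::real)" using root_6_2_bounds by auto
  show "lam \<le> lambda_opt"
  proof -
    \<comment> \<open>The endpoint is excluded from the range, so the inequality is carried to it as
      a weak one by a limit from the left.\<close>
    have ev: "eventually (\<lambda>t. mean_comb lam t \<le> ?m t) (at_left (root 6 2))"
      using eventually_at_left_real[OF c(1)] by eventually_elim (use L in \<open>auto intro: less_imp_le\<close>)
    have "isCont (mean_comb lam) (root 6 2)"
      unfolding mean_comb_def [abs_def] by (intro continuous_intros) auto
    moreover have "isCont ?m (root 6 2)"
      by (intro continuous_intros isCont_o2[where g = arsinh]) auto
    ultimately have "mean_comb lam (root 6 2) \<le> ?m (root 6 2)"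
      by (intro tendsto_le[OF _ _ _ ev]) (auto simp: isCont_def intro: tendsto_mono at_le)
    then have "(lam - lambda_opt) * (7/6 - root 6 2) \<le> 0"
      by (simp add: mean_comb_root_6_2)
    then show ?thesis using c by (simp add: mult_le_0_iff)
  qed
  show "mu \<ge> 8/25"
  proof (rule ccontr)
    assume mu: "\<not> mu \<ge> 8/25"
    \<comment> \<open>Raising a small or negative \<open>mu\<close> to 1/5 preserves the upper
      bound, by monotonicity in \<open>l\<close>, and stays below 8/25.\<close>
    define l where "l = max mu (1/5)"
    obtain t where t: "1 < t" "t < root 6 2" "arsinh_gap l t < 0"
      by (rule arsinh_gap_neg_near_1[of l "root 6 2"]) (use mu c in \<open>auto simp: l_def\<close>)
    have "?m t < mean_comb mu t" using L t by blast
    also have "\<dots> \<le> mean_comb l t" using t by (intro mean_comb_mono) (auto simp: l_def)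
    finally show False using t by (subst (asm) mean_comb_compare_iff) (auto simp: l_def)
  qed
next
  fix t :: real
  assume lam: "lam \<le> lambda_opt" and t: "1 < t" "t < root 6 2"
  have l: "1/5 \<le> lambda_opt" using lambda_opt_bounds by simp
  have zero: "arsinh_gap lambda_opt (root 6 2) = 0"
    by (simp add: arsinh_gap_def mean_comb_root_6_2)
  have "mean_comb lam t \<le> mean_comb lambda_opt t" using lam t by (intro mean_comb_mono)
  also have "\<dots> < sqrt (t^6 - 1) / arsinh (sqrt (t^6 - 1))"
    using arsinh_gap_neg_before_zero[OF l zero t] t l by (subst mean_comb_compare_iff) auto
  finally show "mean_comb lam t < sqrt (t^6 - 1) / arsinh (sqrt (t^6 - 1))" .
next
  fix t :: real
  assume "8/25 \<le> mu" "1 < t"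
  then show "sqrt (t^6 - 1) / arsinh (sqrt (t^6 - 1)) < mean_comb mu t"
    using arsinh_gap_pos[of mu t] by (subst mean_comb_compare_iff) auto
qed

section \<open>From the means to the variable \<open>t\<close>\<close>

text \<open>Since \<open>arsinh\<close> is odd, the quotient is even, so the sign of
  \<open>a - b\<close> is lost harmlessly when passing to \<open>t\<close>.\<close>

lemma sqrt_div_arsinh_sqrt_square:
  "sqrt (v^2) / arsinh (sqrt (v^2)) = v / arsinh (v::real)"
  by (cases "v \<ge> 0") auto

lemma means_eq:
  fixes a b t :: real
  assumes ab: "a > 0" "b > 0" and t: "t > 0" "t^6 = 1 + ((a - b) / (a + b))^2"
  defines "A \<equiv> arithmetic_mean a b"
  shows "A > 0"
    and "l * (1/6 * contraharmonic_mean a b + 5/6 * A)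
           + (1 - l) * (contraharmonic_mean a b powr (1/6) * A powr (5/6)) = A * mean_comb l t"
    and "neuman_sandor_mean a b = A * (sqrt (t^6 - 1) / arsinh (sqrt (t^6 - 1)))"
proof -
  show A: "A > 0" using ab by (simp add: A_def arithmetic_mean_def)
  have "contraharmonic_mean a b = A * (1 + ((a - b) / (a + b))^2)"
    using ab unfolding contraharmonic_mean_def A_def arithmetic_mean_def
    by (simp add: divide_simps) algebra
  then have C: "contraharmonic_mean a b = A * t^6" using t by simp
  have "(t^6) powr (1/6) = t" using powr_powr[of t 6 "1/6"] t(1) by simp
  moreover have "A powr (1/6) * A powr (5/6) = A" using A by (simp flip: powr_add)
  ultimately have "contraharmonic_mean a b powr (1/6) * A powr (5/6) = A * t"
    using A t(1) unfolding C by (simp add: powr_mult)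
  then show "l * (1/6 * contraharmonic_mean a b + 5/6 * A)
           + (1 - l) * (contraharmonic_mean a b powr (1/6) * A powr (5/6)) = A * mean_comb l t"
    unfolding C mean_comb_def by (simp add: field_simps)
  show "neuman_sandor_mean a b = A * (sqrt (t^6 - 1) / arsinh (sqrt (t^6 - 1)))"
    using ab unfolding t(2) neuman_sandor_mean_def A_def arithmetic_mean_def
    by (simp add: sqrt_div_arsinh_sqrt_square del: real_sqrt_abs)
qed

theorem theorem1p2:
  fixes lam mu :: real
  shows "((\<forall>a b. a > 0 \<and> b > 0 \<and> a \<noteq> b \<longrightarrow>
            lam * (1/6 * contraharmonic_mean a b + 5/6 * arithmetic_mean a b)
              + (1 - lam) * (contraharmonic_mean a b powr (1/6) * arithmetic_mean a b powr (5/6))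
              < neuman_sandor_mean a b
          \<and> neuman_sandor_mean a b
              < mu * (1/6 * contraharmonic_mean a b + 5/6 * arithmetic_mean a b)
              + (1 - mu) * (contraharmonic_mean a b powr (1/6) * arithmetic_mean a b powr (5/6)))
        \<longleftrightarrow>
          lam \<le> (6 - 6 * root 6 2 * ln (1 + sqrt 2)) / ((7 - 6 * root 6 2) * ln (1 + sqrt 2))
          \<and> mu \<ge> 8/25)
      \<and> 0.274 \<le> (6 - 6 * root 6 2 * ln (1 + sqrt 2)) / ((7 - 6 * root 6 2) * ln (1 + sqrt 2))
      \<and> (6 - 6 * root 6 2 * ln (1 + sqrt 2)) / ((7 - 6 * root 6 2) * ln (1 + sqrt 2)) < 0.275"
    (is "((\<forall>a b. ?pos a b \<longrightarrow> ?P a b) \<longleftrightarrow> _) \<and> _")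
proof -
  let ?m = "\<lambda>t. sqrt (t^6 - 1) / arsinh (sqrt (t^6 - 1))"
  let ?R = "\<lambda>t. mean_comb lam t < ?m t \<and> ?m t < mean_comb mu t"
  have key: "?P a b \<longleftrightarrow> ?R t"
    if "a > 0" "b > 0" "t > 0" "t^6 = 1 + ((a - b) / (a + b))^2" for a b t
    using means_eq(1)[OF that] by (simp only: means_eq(2,3)[OF that] mult_less_cancel_left_pos)
  \<comment> \<open>Over distinct positive \<open>a\<close> and \<open>b\<close>, the square of
    \<open>(a - b) / (a + b)\<close> takes exactly the values in (0, 1), so \<open>t\<close> runs
    exactly through the open interval from 1 to \<open>root 6 2\<close>.\<close>
  have "(\<forall>a b. ?pos a b \<longrightarrow> ?P a b) \<longleftrightarrow> (\<forall>t. 1 < t \<and> t < root 6 2 \<longrightarrow> ?R t)"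
  proof (intro iffI allI impI)
    fix t :: real
    assume P: "\<forall>a b. ?pos a b \<longrightarrow> ?P a b" and t: "1 < t \<and> t < root 6 2"
    define v where "v = sqrt (t^6 - 1)"
    have "t^6 < (root 6 2)^6" using t by (intro power_strict_mono) auto
    moreover have "t^6 > 1" using t by simp
    ultimately have v: "0 < v" "v < 1" "v^2 = t^6 - 1" by (auto simp: v_def)
    \<comment> \<open>The pair \<open>1 + v\<close>, \<open>1 - v\<close> has arithmetic mean 1 and
      \<open>(a - b) / (a + b) = v\<close>; both entries are positive as
      \<open>v < 1\<close>.\<close>
    then show "?R t" using key[of "1 + v" "1 - v" t] P t by auto
  next
    fix a b :: real
    assume R: "\<forall>t. 1 < t \<and> t < root 6 2 \<longrightarrow> ?R t" and ab: "?pos a b"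
    define v t where "v = (a - b) / (a + b)" and "t = root 6 (1 + v^2)"
    have "\<bar>v\<bar> < 1" "v \<noteq> 0" using ab by (auto simp: v_def abs_if field_simps)
    then have v: "v^2 > 0" "v^2 < 1" by (auto simp: abs_square_less_1)
    then have "1 < t" "t < root 6 2" "t^6 = 1 + v^2" by (auto simp: t_def)
    then show "?P a b" using key[of a b t] R ab by (auto simp: v_def)
  qed
  then show ?thesis
    using mean_comb_bounds_iff[of lam mu] lambda_opt_bounds by (simp add: lambda_opt_def)
qed

end
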